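(* Fix integers $t\ge s\ge0$ and an assignment rule $\mathcal X$. For any non-negative measurable function $u:\mathbb Y^t\to[0,\infty]$, $$\mathsf E\big[u(Y_1,\dots,Y_t);\ \Theta_{\mathcal X}=s\big]=\mathsf E\big[u(Y_1,\dots,Y_t)\,\mathsf R^s_t;\ \Theta_{\mathcal X}>t\big],\qquad\text{where}\quad \mathsf R^s_t=\Pi_s\prod_{j=s}^t\frac{\Lambda_j}{1-\Pi_j}.$$
   Context: Setup. Fix $2\le K<\infty$, $[K]=\{1,\dots,K\}$, $\mathbb N=\{1,2,\dots\}$. There is a latent process $L_t\in\{0,1\}$, $t\ge0$, with $L_t=0$ for $t<\Theta$ and $L_t=1$ for $t\ge\Theta$ ($\Theta=\Theta_{\mathcal X}$ is the change-point). At each $t\in\mathbb N$ a treatment $X_t\in[K]$ is selected and a response $Y_t$ in a Polish space $\mathbb Y$ is observed; $\mathcal F_t=\sigma(X_s,Y_s:1\le s\le t)$, $\mathcal F_0$ trivial. An assignment rule $\mathcal X=\{X_t\}$ has $X_1$ deterministic and $X_t$ a measurable function of $X_1,\dots,X_{t-1},Y_1,\dots,Y_{t-1}$. Response model: for each $x\in[K]$, $f_x,g_x$ are densities with respect to a $\sigma$-finite measure $\mu$ on $\mathbb Y$; given $X_t=x,L_t=i,\mathcal F_{t-1},L_0,\dots,L_{t-1}$, $Y_t$ has density $f_x$ if $i=0$, $g_x$ if $i=1$. The likelihood ratios $g_x/f_x$ are assumed well defined, i.e. $f_x$ and $g_x$ vanish on the same set up to a $\mu$-null set. Change-point model: $\pi_0\in[0,1)$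 and functions $\pi_t:[K]^t\to[0,1)$ with $\mathsf P(L_0=1)=\pi_0$ and $\mathsf P(L_t=1\mid L_{t-1}=0,\mathcal F_{t-1},X_t)=\Pi_t:=\pi_t(X_1,\dots,X_t)$ for $t\ge1$; $\Pi_0:=\pi_0$. $\Lambda_0:=1$ and $\Lambda_t:=g_{X_t}(Y_t)/f_{X_t}(Y_t)$ for $t\ge1$. $\mathsf E[Z;A]$ means $\mathsf E[Z\mathbf 1_A]$. *)

theory Defs
  imports "HOL-Probability.Probability" "HOL-Library.Extended_Nat"
begin

text \<open>
  Treatments are the naturals \<open>{1..K}\<close>; times at which treatments and responses are observed are
  the naturals from 1 on, so the values \<open>X 0\<close> and \<open>Y 0\<close> are never used. A finite
  sequence of treatments or responses is an extensional function on \<open>{1..t}\<close>. The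
  change-point takes values in \<open>enat\<close>, with \<open>\<infinity>\<close> meaning that the change never occurs.
\<close>

definition latent :: "('w \<Rightarrow> enat) \<Rightarrow> nat \<Rightarrow> 'w \<Rightarrow> nat" where
  "latent \<Theta> t \<omega> = (if enat t < \<Theta> \<omega> then 0 else 1)"

definition history :: "'w measure \<Rightarrow> (nat \<Rightarrow> 'w \<Rightarrow> nat) \<Rightarrow>
    (nat \<Rightarrow> 'w \<Rightarrow> 'y::topological_space) \<Rightarrow> nat \<Rightarrow> 'w measure" where
  "history M X Y t = sigma (space M)
     ((\<Union>i\<in>{1..t}. sets (vimage_algebra (space M) (X i) (count_space UNIV))) \<union>
      (\<Union>i\<in>{1..t}. sets (vimage_algebra (space M) (Y i) borel)))"

text \<open>The sigma-algebra generated by the history up to \<open>t - 1\<close>, \<open>X t\<close> and \<open>L i\<close> for \<open>i \<in> I\<close>.\<close>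

definition history_latent :: "'w measure \<Rightarrow> (nat \<Rightarrow> 'w \<Rightarrow> nat) \<Rightarrow>
    (nat \<Rightarrow> 'w \<Rightarrow> 'y::topological_space) \<Rightarrow> ('w \<Rightarrow> enat) \<Rightarrow> nat \<Rightarrow> nat set \<Rightarrow> 'w measure" where
  "history_latent M X Y \<Theta> t I = sigma (space M)
     (sets (history M X Y (t - 1)) \<union>
      sets (vimage_algebra (space M) (X t) (count_space UNIV)) \<union>
      (\<Union>i\<in>I. sets (vimage_algebra (space M) (latent \<Theta> i) (count_space UNIV))))"

definition assignment_rule :: "'w measure \<Rightarrow> nat \<Rightarrow> (nat \<Rightarrow> 'w \<Rightarrow> nat) \<Rightarrow>
    (nat \<Rightarrow> 'w \<Rightarrow> 'y::topological_space) \<Rightarrow> bool" where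
  "assignment_rule M K X Y \<longleftrightarrow>
     (\<exists>x\<in>{1..K}. \<forall>\<omega>\<in>space M. X 1 \<omega> = x) \<and>
     (\<forall>t\<ge>2. \<exists>h \<in> (\<Pi>\<^sub>M i\<in>{1..t - 1}. count_space {1..K}) \<Otimes>\<^sub>M (\<Pi>\<^sub>M i\<in>{1..t - 1}. borel)
                    \<rightarrow>\<^sub>M count_space {1..K}.
        \<forall>\<omega>\<in>space M. X t \<omega> = h ((\<lambda>i\<in>{1..t - 1}. X i \<omega>), (\<lambda>i\<in>{1..t - 1}. Y i \<omega>)))"

definition trans_prob :: "real \<Rightarrow> (nat \<Rightarrow> (nat \<Rightarrow> nat) \<Rightarrow> real) \<Rightarrow> (nat \<Rightarrow> 'w \<Rightarrow> nat) \<Rightarrow>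
    nat \<Rightarrow> 'w \<Rightarrow> real" where
  "trans_prob \<pi>\<^sub>0 \<pi> X t \<omega> = (if t = 0 then \<pi>\<^sub>0 else \<pi> t (\<lambda>i\<in>{1..t}. X i \<omega>))"

definition lik_ratio :: "(nat \<Rightarrow> 'y \<Rightarrow> real) \<Rightarrow> (nat \<Rightarrow> 'y \<Rightarrow> real) \<Rightarrow> (nat \<Rightarrow> 'w \<Rightarrow> nat) \<Rightarrow>
    (nat \<Rightarrow> 'w \<Rightarrow> 'y) \<Rightarrow> nat \<Rightarrow> 'w \<Rightarrow> real" where
  "lik_ratio f g X Y t \<omega> = (if t = 0 then 1 else g (X t \<omega>) (Y t \<omega>) / f (X t \<omega>) (Y t \<omega>))"

definition R_stat :: "(nat \<Rightarrow> 'y \<Rightarrow> real) \<Rightarrow> (nat \<Rightarrow> 'y \<Rightarrow> real) \<Rightarrow> real \<Rightarrow>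
    (nat \<Rightarrow> (nat \<Rightarrow> nat) \<Rightarrow> real) \<Rightarrow> (nat \<Rightarrow> 'w \<Rightarrow> nat) \<Rightarrow> (nat \<Rightarrow> 'w \<Rightarrow> 'y) \<Rightarrow>
    nat \<Rightarrow> nat \<Rightarrow> 'w \<Rightarrow> real" where
  "R_stat f g \<pi>\<^sub>0 \<pi> X Y s t \<omega> =
     trans_prob \<pi>\<^sub>0 \<pi> X s \<omega> *
     (\<Prod>j=s..t. lik_ratio f g X Y j \<omega> / (1 - trans_prob \<pi>\<^sub>0 \<pi> X j \<omega>))"

locale change_point_model = prob_space M
  for M :: "'w measure" +
  fixes K :: nat
    and \<mu> :: "'y::polish_space measure"
    and f g :: "nat \<Rightarrow> 'y \<Rightarrow> real"
    and \<pi>\<^sub>0 :: real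
    and \<pi> :: "nat \<Rightarrow> (nat \<Rightarrow> nat) \<Rightarrow> real"
    and X :: "nat \<Rightarrow> 'w \<Rightarrow> nat"
    and Y :: "nat \<Rightarrow> 'w \<Rightarrow> 'y"
    and \<Theta> :: "'w \<Rightarrow> enat"
  assumes K_ge_2: "2 \<le> K"
    and sigma_finite_\<mu>: "sigma_finite_measure \<mu>"
    and sets_\<mu>: "sets \<mu> = sets borel"
    and f_measurable: "\<And>x. x \<in> {1..K} \<Longrightarrow> f x \<in> borel_measurable \<mu>"
    and f_nonneg: "\<And>x y. x \<in> {1..K} \<Longrightarrow> 0 \<le> f x y"
    and f_integral: "\<And>x. x \<in> {1..K} \<Longrightarrow> (\<integral>\<^sup>+y. ennreal (f x y) \<partial>\<mu>) = 1"
    and g_measurable: "\<And>x. x \<in> {1..K} \<Longrightarrow> g x \<in> borel_measurable \<mu>"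
    and g_nonneg: "\<And>x y. x \<in> {1..K} \<Longrightarrow> 0 \<le> g x y"
    and g_integral: "\<And>x. x \<in> {1..K} \<Longrightarrow> (\<integral>\<^sup>+y. ennreal (g x y) \<partial>\<mu>) = 1"
    and same_zeros: "\<And>x. x \<in> {1..K} \<Longrightarrow> AE y in \<mu>. f x y = 0 \<longleftrightarrow> g x y = 0"
    and \<pi>\<^sub>0_range: "\<pi>\<^sub>0 \<in> {0..<1}"
    and \<pi>_range: "\<And>t. 1 \<le> t \<Longrightarrow> \<pi> t \<in> ({1..t} \<rightarrow>\<^sub>E {1..K}) \<rightarrow> {0..<1}"
    and Y_measurable: "\<And>t. 1 \<le> t \<Longrightarrow> Y t \<in> M \<rightarrow>\<^sub>M borel"
    and \<Theta>_measurable: "\<Theta> \<in> M \<rightarrow>\<^sub>M count_space UNIV"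
    and rule: "assignment_rule M K X Y"
    and initial: "prob {\<omega>\<in>space M. latent \<Theta> 0 \<omega> = 1} = \<pi>\<^sub>0"
    and transition: "\<And>t. 1 \<le> t \<Longrightarrow>
      AE \<omega> in M. latent \<Theta> (t - 1) \<omega> = 0 \<longrightarrow>
        real_cond_exp M (history_latent M X Y \<Theta> t {t - 1})
          (indicator {\<omega>\<in>space M. latent \<Theta> t \<omega> = 1}) \<omega> = trans_prob \<pi>\<^sub>0 \<pi> X t \<omega>"
    and response: "\<And>t B. 1 \<le> t \<Longrightarrow> B \<in> sets borel \<Longrightarrow>
      AE \<omega> in M.
        real_cond_exp M (history_latent M X Y \<Theta> t {0..t})
          (indicator {\<omega>\<in>space M. Y t \<omega> \<in> B}) \<omega> =
        measure (density \<mu> (\<lambda>y. ennreal (if latent \<Theta> t \<omega> = 0 then f (X t \<omega>) y else g (X t \<omega>) y))) B"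

end

theory Submission imports Defs begin

text \<open>
  By induction on \<open>t\<close> the identity holds for every nonnegative \<open>\<F>\<^sub>t\<close>-measurable weight, not only for
  functions of the responses. In the step it suffices to test the weights \<open>1\<^sub>B 1\<^sub>C(Y\<^sub>t\<^sub>+\<^sub>1)\<close> with
  \<open>B \<in> \<F>\<^sub>t\<close>, since \<open>X\<^sub>t\<^sub>+\<^sub>1\<close> is \<open>\<F>\<^sub>t\<close>-measurable. After the change, the response integrates out to
  \<open>\<integral>\<^sub>C g\<^sub>x d\<mu>\<close>; the hypothesis at time \<open>t\<close> moves the integral to \<open>{\<Theta> > t}\<close>; dividing by
  \<open>1 - \<Pi>\<^sub>t\<^sub>+\<^sub>1\<close> restricts it to \<open>{\<Theta> > t + 1}\<close>; and there \<open>\<integral>\<^sub>C g\<^sub>x d\<mu> = \<integral>\<^sub>C (g\<^sub>x/f\<^sub>x) f\<^sub>x d\<mu>\<close>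
  is the integral of \<open>\<Lambda>\<^sub>t\<^sub>+\<^sub>1\<close> against the response law before the change.
  For \<open>s = t + 1\<close> the same step applies, with \<open>\<Pi>\<^sub>s\<close> in the role of \<open>R\<^sup>s\<^sub>t\<close>.
\<close>

section \<open>Conditional expectations and agreement of measures on a generator\<close>

text \<open>\<open>real_cond_exp\<close> is the difference of the real values of two
  \<open>nn_cond_exp\<close>. For an indicator the negative part gives 0 and the positive part is at
  most 1 almost everywhere, so nothing is lost in passing to the reals, and the defining property of
  \<open>nn_cond_exp\<close> applies. This turns the model assumptions into identities for weights
  \<open>W\<close> that may be non-integrable.\<close>

lemma (in finite_measure) nn_integral_indicator_real_cond_exp:
  assumes sub: "subalgebra M F" and A [measurable]: "A \<in> sets M"
    and W: "W \<in> borel_measurable F"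
  shows "(\<integral>\<^sup>+x. W x * indicator A x \<partial>M) =
    (\<integral>\<^sup>+x. W x * ennreal (real_cond_exp M F (indicator A) x) \<partial>M)"
proof -
  interpret finite_measure_subalgebra M F
    by unfold_locales (rule sub)
  let ?N = "nn_cond_exp M F (\<lambda>x. ennreal (indicator A x))"
  have neg: "nn_cond_exp M F (\<lambda>x. ennreal (- indicator A x)) = nn_cond_exp M F (\<lambda>x. 0)"
    by (rule arg_cong[where f = "nn_cond_exp M F"]) (auto simp: fun_eq_iff indicator_def ennreal_neg)
  have "AE x in M. nn_cond_exp M F (\<lambda>x. 0) x = (0 :: ennreal)"
    using nn_cond_exp_F_meas[of "\<lambda>x. 0"] by auto
  moreover have "AE x in M. ?N x \<le> nn_cond_exp M F (\<lambda>x. 1) x"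
    by (rule nn_cond_exp_mono) (auto simp: indicator_def)
  moreover have "AE x in M. nn_cond_exp M F (\<lambda>x. 1) x = (1 :: ennreal)"
    using nn_cond_exp_F_meas[of "\<lambda>x. 1"] by auto
  ultimately have eq: "AE x in M. ennreal (real_cond_exp M F (indicator A) x) = ?N x"
    unfolding real_cond_exp_def neg
    by eventually_elim (simp add: order_le_less_trans[OF _ ennreal_one_less_top])
  have "(\<integral>\<^sup>+x. W x * indicator A x \<partial>M) = (\<integral>\<^sup>+x. W x * ?N x \<partial>M)"
    by (subst nn_cond_exp_intg) (auto simp: W ennreal_indicator)
  also have "\<dots> = (\<integral>\<^sup>+x. W x * ennreal (real_cond_exp M F (indicator A) x) \<partial>M)"
    by (rule nn_integral_cong_AE) (use eq in auto)
  finally show ?thesis .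
qed

text \<open>The densities \<open>a\<close> and \<open>b\<close> define two measures on
  \<open>F\<close> that agree on an intersection-stable generator containing the whole space, hence
  everywhere on \<open>F\<close>. Finiteness is asked of \<open>a\<close> alone, because
  \<open>space M \<in> E\<close> makes the two total masses equal.\<close>

lemma nn_integral_eq_of_generator:
  assumes sub: "subalgebra M F"
    and gen: "sets F = sigma_sets (space M) E" "Int_stable E" "E \<subseteq> Pow (space M)" "space M \<in> E"
    and [measurable]: "a \<in> borel_measurable M" "b \<in> borel_measurable M"
    and fin: "(\<integral>\<^sup>+x. a x \<partial>M) \<noteq> \<infinity>"
    and eq: "\<And>A. A \<in> E \<Longrightarrow> (\<integral>\<^sup>+x. a x * indicator A x \<partial>M) = (\<integral>\<^sup>+x. b x * indicator A x \<partial>M)"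
    and W [measurable]: "W \<in> borel_measurable F"
  shows "(\<integral>\<^sup>+x. W x * a x \<partial>M) = (\<integral>\<^sup>+x. W x * b x \<partial>M)"
proof -
  let ?D = "\<lambda>h. distr (density M h) F (\<lambda>x. x)"
  \<comment> \<open>The image under the identity into \<open>F\<close> is the restriction of
    \<open>density M h\<close> to the smaller sigma-algebra.\<close>
  have id: "(\<lambda>x. x) \<in> density M h \<rightarrow>\<^sub>M F" for h
    using measurable_from_subalg[OF sub measurable_ident] by (simp add: id_def cong: measurable_cong_sets)
  have sp: "space F = space M" and ss: "sets F \<subseteq> sets M"
    using sub by (auto simp: subalgebra_def)
  have em: "emeasure (?D h) A = (\<integral>\<^sup>+x. h x * indicator A x \<partial>M)"
    if "A \<in> sets F" and h: "h \<in> borel_measurable M" for h A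
  proof -
    have "A \<inter> space M = A" "A \<in> sets M"
      using that ss sets.sets_into_space[of A M] by auto
    then show ?thesis
      using that by (subst emeasure_distr[OF id]) (auto simp: emeasure_density)
  qed
  have WM [measurable]: "W \<in> borel_measurable M"
    by (rule measurable_from_subalg[OF sub W])
  have int: "integral\<^sup>N (?D h) W = (\<integral>\<^sup>+x. W x * h x \<partial>M)"
    if [measurable]: "h \<in> borel_measurable M" for h
    by (subst nn_integral_distr[OF id]) (auto simp: nn_integral_density mult.commute)
  have EF: "A \<in> sets F" if "A \<in> E" for A
    using that gen by auto
  have "?D a = ?D b"
  proof (rule measure_eqI_generator_eq[where \<Omega> = "space M" and E = E and A = "\<lambda>_. space M"])
    show "emeasure (?D a) (space M) \<noteq> \<infinity>" for i :: nat
      using fin EF[OF gen(4)] by (simp add: em cong: nn_integral_cong)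
    show "emeasure (?D a) A = emeasure (?D b) A" if "A \<in> E" for A
      using that by (simp add: em EF eq)
  qed (use gen in auto)
  then show ?thesis
    using int[of a] int[of b] by simp
qed

section \<open>Sigma-algebras generated by the history and the latent states\<close>

lemma measurable_of_vimage_algebra:
  assumes "sets (vimage_algebra (space N) h L) \<subseteq> sets N" "h \<in> space N \<rightarrow> space L"
  shows "h \<in> N \<rightarrow>\<^sub>M L"
proof (rule measurableI)
  fix A assume "A \<in> sets L"
  then show "h -` A \<inter> space N \<in> sets N"
    using in_vimage_algebra assms(1) by blast
qed (use assms(2) in auto)

text \<open>The assignment rule yields treatments in \<open>count_space {1..K}\<close>, whereas
  \<open>history\<close> pulls them back from \<open>count_space UNIV\<close>.\<close>

lemma measurable_into_UNIV:
  "h \<in> N \<rightarrow>\<^sub>M count_space A \<Longrightarrow> h \<in> N \<rightarrow>\<^sub>M count_space UNIV"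
  by (rule measurable_compose[where g = "\<lambda>x. x"]) auto

lemma space_history [simp]: "space (history M X Y t) = space M"
  by (simp add: history_def space_measure_of_conv)

lemma space_history_latent [simp]: "space (history_latent M X Y \<Theta> t I) = space M"
  by (simp add: history_latent_def space_measure_of_conv)

text \<open>\<open>sigma\<close> has the generated sets as its measurable sets once the generators
  are subsets of \<open>space M\<close>. This is checked here, so that inclusions of sigma-algebras
  reduce to inclusions of generators.\<close>

lemma sets_history:
  fixes M :: "'a measure" and Y :: "nat \<Rightarrow> 'a \<Rightarrow> 'c::topological_space"
  shows
  "sets (history M X Y t) = sigma_sets (space M)
     ((\<Union>i\<in>{1..t}. sets (vimage_algebra (space M) (X i) (count_space UNIV))) \<union>
      (\<Union>i\<in>{1..t}. sets (vimage_algebra (space M) (Y i) borel)))"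
proof -
  have "sets (vimage_algebra (space M) h L) \<subseteq> Pow (space M)" for h :: "'a \<Rightarrow> 'c" and L
    using sets.space_closed[of "vimage_algebra (space M) h L"] by simp
  moreover have "sets (vimage_algebra (space M) h L) \<subseteq> Pow (space M)" for h :: "'a \<Rightarrow> nat" and L
    using sets.space_closed[of "vimage_algebra (space M) h L"] by simp
  ultimately show ?thesis
    unfolding history_def by (intro sets_measure_of Un_least UN_least)
qed

lemma sets_history_latent:
  fixes M :: "'a measure" and Y :: "nat \<Rightarrow> 'a \<Rightarrow> 'c::topological_space"
  shows
  "sets (history_latent M X Y \<Theta> t I) = sigma_sets (space M)
     (sets (history M X Y (t - 1)) \<union>
      sets (vimage_algebra (space M) (X t) (count_space UNIV)) \<union>
      (\<Union>i\<in>I. sets (vimage_algebra (space M) (latent \<Theta> i) (count_space UNIV))))"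
proof -
  have "sets (vimage_algebra (space M) h L) \<subseteq> Pow (space M)" for h :: "'a \<Rightarrow> nat" and L
    using sets.space_closed[of "vimage_algebra (space M) h L"] by simp
  moreover have "sets (history M X Y (t - 1)) \<subseteq> Pow (space M)"
    using sets.space_closed[of "history M X Y (t - 1)"] by simp
  ultimately show ?thesis
    unfolding history_latent_def by (intro sets_measure_of Un_least UN_least)
qed

lemma measurable_history_Y:
  assumes "i \<in> {1..t}"
  shows "Y i \<in> history M X Y t \<rightarrow>\<^sub>M borel"
  by (rule measurable_of_vimage_algebra) (use assms in \<open>auto simp: sets_history\<close>)

lemma subalgebra_history_mono: "subalgebra (history M X Y t) (history M X Y j)" if "j \<le> t"
  unfolding subalgebra_def sets_history using that by (intro conjI sigma_sets_mono') auto

text \<open>Stated at \<open>Suc t\<close>, because \<open>history_latent\<close> at a time contains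
  the history up to the time before.\<close>

lemma subalgebra_history_latent:
  "subalgebra (history_latent M X Y \<Theta> (Suc t) I) (history M X Y t)"
  unfolding subalgebra_def by (auto simp: sets_history_latent)

lemma measurable_history_latent_latent:
  assumes "i \<in> I"
  shows "latent \<Theta> i \<in> history_latent M X Y \<Theta> t I \<rightarrow>\<^sub>M count_space UNIV"
  by (rule measurable_of_vimage_algebra) (use assms in \<open>auto simp: sets_history_latent\<close>)

context change_point_model
begin

section \<open>Measurability of treatments, transition probabilities and likelihood ratios\<close>

text \<open>Strong induction on \<open>t\<close>: the rule uses earlier treatments and responses,
  and the earlier treatments are themselves determined by still earlier responses. The measure
  \<open>N\<close> is kept general so that it can be \<open>M\<close> or a history.\<close>

lemma measurable_X_of_past:
  assumes "space N = space M" "\<And>i. 1 \<le> i \<Longrightarrow> i < t \<Longrightarrow> Y i \<in> N \<rightarrow>\<^sub>M borel" "1 \<le> t"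
  shows "X t \<in> N \<rightarrow>\<^sub>M count_space {1..K}"
  using assms(2,3)
proof (induction t rule: less_induct)
  case (less t)
  show ?case
  proof (cases "t = 1")
    case True
    obtain x where x: "x \<in> {1..K}" "\<forall>\<omega>\<in>space M. X 1 \<omega> = x"
      using rule unfolding assignment_rule_def by auto
    then have "X 1 \<in> N \<rightarrow>\<^sub>M count_space {1..K} \<longleftrightarrow> (\<lambda>_. x) \<in> N \<rightarrow>\<^sub>M count_space {1..K}"
      using assms(1) by (intro measurable_cong) auto
    with x True show ?thesis by simp
  next
    case False
    with less.prems have t: "2 \<le> t" by auto
    then obtain h where h: "h \<in> (\<Pi>\<^sub>M i\<in>{1..t - 1}. count_space {1..K}) \<Otimes>\<^sub>M (\<Pi>\<^sub>M i\<in>{1..t - 1}. borel)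
                    \<rightarrow>\<^sub>M count_space {1..K}"
      "\<forall>\<omega>\<in>space M. X t \<omega> = h ((\<lambda>i\<in>{1..t - 1}. X i \<omega>), (\<lambda>i\<in>{1..t - 1}. Y i \<omega>))"
      using rule unfolding assignment_rule_def by blast
    have X: "X i \<in> N \<rightarrow>\<^sub>M count_space {1..K}" if "i \<in> {1..t - 1}" for i
      using that t by (intro less.IH less.prems) auto
    have Y: "Y i \<in> N \<rightarrow>\<^sub>M borel" if "i \<in> {1..t - 1}" for i
      using that t by (intro less.prems) auto
    have "(\<lambda>\<omega>. h ((\<lambda>i\<in>{1..t - 1}. X i \<omega>), (\<lambda>i\<in>{1..t - 1}. Y i \<omega>))) \<in> N \<rightarrow>\<^sub>M count_space {1..K}"
      by (rule measurable_compose[OF _ h(1)])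
        (intro measurable_Pair measurable_restrict X Y)
    then show ?thesis
      by (subst measurable_cong) (use h(2) assms(1) in auto)
  qed
qed

lemma measurable_X: "1 \<le> t \<Longrightarrow> X t \<in> M \<rightarrow>\<^sub>M count_space {1..K}"
  by (rule measurable_X_of_past) (auto intro: Y_measurable)

text \<open>The bound is \<open>Suc t\<close>, one beyond the history: the treatment at
  \<open>Suc t\<close> is fixed by the responses up to \<open>t\<close>.\<close>

lemma measurable_history_X:
  "1 \<le> i \<Longrightarrow> i \<le> Suc t \<Longrightarrow> X i \<in> history M X Y t \<rightarrow>\<^sub>M count_space {1..K}"
  by (rule measurable_X_of_past) (auto intro: measurable_history_Y)

lemma X_range: "1 \<le> t \<Longrightarrow> \<omega> \<in> space M \<Longrightarrow> X t \<omega> \<in> {1..K}"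
  using measurable_space[OF measurable_X] by auto

lemma measurable_latent: "latent \<Theta> i \<in> M \<rightarrow>\<^sub>M count_space UNIV"
  unfolding latent_def
  by (rule measurable_compose[OF \<Theta>_measurable, where g = "\<lambda>\<theta>. if enat i < \<theta> then 0 else 1"]) auto

lemma subalgebra_M_history: "subalgebra M (history M X Y t)"
proof -
  have "sets (vimage_algebra (space M) (X i) (count_space UNIV)) \<subseteq> sets M" if "i \<in> {1..t}" for i
    using that by (intro sets_image_in_sets measurable_into_UNIV[OF measurable_X]) auto
  moreover have "sets (vimage_algebra (space M) (Y i) borel) \<subseteq> sets M" if "i \<in> {1..t}" for i
    using that by (intro sets_image_in_sets Y_measurable) auto
  ultimately show ?thesis
    unfolding subalgebra_def sets_history
    by (intro conjI sets.sigma_sets_subset Un_least UN_least) auto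
qed

lemma subalgebra_M_history_latent: "subalgebra M (history_latent M X Y \<Theta> (Suc t) I)"
proof -
  have "sets (history M X Y t) \<subseteq> sets M"
    using subalgebra_M_history[of t] by (auto simp: subalgebra_def)
  moreover have "sets (vimage_algebra (space M) (X (Suc t)) (count_space UNIV)) \<subseteq> sets M"
    by (intro sets_image_in_sets measurable_into_UNIV[OF measurable_X]) auto
  moreover have "sets (vimage_algebra (space M) (latent \<Theta> i) (count_space UNIV)) \<subseteq> sets M" for i
    by (intro sets_image_in_sets measurable_latent) auto
  ultimately show ?thesis
    unfolding subalgebra_def sets_history_latent
    by (intro conjI sets.sigma_sets_subset Un_least UN_least) auto
qed

text \<open>The next treatment carries no new information, so the next transition probability is
  already known.\<close>

lemma measurable_trans_prob: "trans_prob \<pi>\<^sub>0 \<pi> X (Suc t) \<in> borel_measurable (history M X Y t)"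
proof -
  have "(\<lambda>\<omega>. \<lambda>i\<in>{1..Suc t}. X i \<omega>) \<in> history M X Y t \<rightarrow>\<^sub>M (\<Pi>\<^sub>M i\<in>{1..Suc t}. count_space {1..K})"
    by (intro measurable_restrict measurable_history_X) auto
  also have "(\<Pi>\<^sub>M i\<in>{1..Suc t}. count_space {1..K}) = count_space ({1..Suc t} \<rightarrow>\<^sub>E {1..K})"
    by (rule count_space_PiM_finite) auto
  finally have "(\<lambda>\<omega>. \<pi> (Suc t) (\<lambda>i\<in>{1..Suc t}. X i \<omega>)) \<in> borel_measurable (history M X Y t)"
    by (rule measurable_compose) auto
  then show ?thesis
    by (simp add: trans_prob_def[abs_def])
qed

lemma trans_prob_range: "\<omega> \<in> space M \<Longrightarrow> trans_prob \<pi>\<^sub>0 \<pi> X t \<omega> \<in> {0..<1}"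
proof (cases "t = 0")
  case False
  assume \<omega>: "\<omega> \<in> space M"
  have "(\<lambda>i\<in>{1..t}. X i \<omega>) \<in> {1..t} \<rightarrow>\<^sub>E {1..K}"
    by (rule restrict_PiE_iff[THEN iffD2]) (use X_range[OF _ \<omega>] in auto)
  with False show ?thesis
    using \<pi>_range[of t] by (auto simp: trans_prob_def Pi_iff)
qed (use \<pi>\<^sub>0_range in \<open>simp add: trans_prob_def\<close>)

text \<open>\<open>f\<close> and \<open>g\<close> are measurable only in the response, for each
  treatment separately. As there are countably many treatments, the sections can be glued along the
  value of \<open>X t\<close>.\<close>

lemma measurable_compose_X_Y:
  assumes "X t \<in> N \<rightarrow>\<^sub>M count_space {1..K}" "Y t \<in> N \<rightarrow>\<^sub>M borel"
    and "\<And>x. x \<in> {1..K} \<Longrightarrow> h x \<in> borel \<rightarrow>\<^sub>M L"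
  shows "(\<lambda>\<omega>. h (X t \<omega>) (Y t \<omega>)) \<in> N \<rightarrow>\<^sub>M L"
  by (rule measurable_compose_countable'[OF _ assms(1)])
    (auto intro: measurable_compose[OF assms(2) assms(3)])

lemma borel_measurable_f: "x \<in> {1..K} \<Longrightarrow> f x \<in> borel_measurable borel"
  using f_measurable measurable_cong_sets[OF sets_\<mu> refl] by blast

lemma borel_measurable_g: "x \<in> {1..K} \<Longrightarrow> g x \<in> borel_measurable borel"
  using g_measurable measurable_cong_sets[OF sets_\<mu> refl] by blast

lemma measurable_lik_ratio: "lik_ratio f g X Y t \<in> borel_measurable (history M X Y t)"
proof (cases "t = 0")
  case False
  have "(\<lambda>\<omega>. (\<lambda>x y. g x y / f x y) (X t \<omega>) (Y t \<omega>)) \<in> borel_measurable (history M X Y t)"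
  proof (rule measurable_compose_X_Y)
    show "X t \<in> history M X Y t \<rightarrow>\<^sub>M count_space {1..K}"
      using False by (intro measurable_history_X) auto
    show "Y t \<in> history M X Y t \<rightarrow>\<^sub>M borel"
      using False by (intro measurable_history_Y) auto
  qed (intro borel_measurable_divide borel_measurable_f borel_measurable_g)
  then show ?thesis
    using False by (simp add: lik_ratio_def[abs_def])
qed (simp add: lik_ratio_def[abs_def])

lemma lik_ratio_nonneg:
  assumes "\<omega> \<in> space M"
  shows "0 \<le> lik_ratio f g X Y t \<omega>"
proof (cases "t = 0")
  case False
  then have "X t \<omega> \<in> {1..K}"
    using assms by (intro X_range) auto
  with False show ?thesis
    using f_nonneg g_nonneg by (simp add: lik_ratio_def)
qed (simp add: lik_ratio_def)

section \<open>Events of the latent process and the transition law\<close>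

lemma latent_eq_0_iff: "latent \<Theta> i \<omega> = 0 \<longleftrightarrow> enat i < \<Theta> \<omega>"
  by (simp add: latent_def)

lemma eq_enat_Suc_iff: "\<Theta> \<omega> = enat (Suc t) \<longleftrightarrow> enat t < \<Theta> \<omega> \<and> \<not> enat (Suc t) < \<Theta> \<omega>"
  by (cases "\<Theta> \<omega>") auto

lemma sets_history_latent_less:
  assumes "i \<in> I"
  shows "{\<omega>\<in>space M. enat i < \<Theta> \<omega>} \<in> sets (history_latent M X Y \<Theta> t I)"
proof -
  have "latent \<Theta> i -` {0} \<inter> space (history_latent M X Y \<Theta> t I) \<in> sets (history_latent M X Y \<Theta> t I)"
    by (rule measurable_sets[OF measurable_history_latent_latent[OF assms]]) simp
  also have "latent \<Theta> i -` {0} \<inter> space (history_latent M X Y \<Theta> t I) = {\<omega>\<in>space M. enat i < \<Theta> \<omega>}"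
    by (auto simp: latent_eq_0_iff)
  finally show ?thesis .
qed

text \<open>A change at \<open>s\<close> means state 0 at \<open>s - 1\<close> and state 1 at
  \<open>s\<close>, hence the two indices required in \<open>I\<close>. For \<open>s = 0\<close>
  truncated subtraction makes them coincide, and the event is the complement of a positive
  change-point.\<close>

lemma sets_history_latent_eq:
  assumes "s \<in> I" "s - 1 \<in> I"
  shows "{\<omega>\<in>space M. \<Theta> \<omega> = enat s} \<in> sets (history_latent M X Y \<Theta> t I)"
proof (cases s)
  case 0
  have "space (history_latent M X Y \<Theta> t I) - {\<omega>\<in>space M. enat s < \<Theta> \<omega>} \<in> sets (history_latent M X Y \<Theta> t I)"
    by (intro sets.Diff sets.top sets_history_latent_less assms)
  also have "space (history_latent M X Y \<Theta> t I) - {\<omega>\<in>space M. enat s < \<Theta> \<omega>} = {\<omega>\<in>space M. \<Theta> \<omega> = enat s}"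
    using 0 by (auto simp: not_less zero_enat_def[symmetric])
  finally show ?thesis .
next
  case (Suc r)
  have "{\<omega>\<in>space M. enat (s - 1) < \<Theta> \<omega>} - {\<omega>\<in>space M. enat s < \<Theta> \<omega>} \<in> sets (history_latent M X Y \<Theta> t I)"
    by (intro sets.Diff sets_history_latent_less assms)
  also have "{\<omega>\<in>space M. enat (s - 1) < \<Theta> \<omega>} - {\<omega>\<in>space M. enat s < \<Theta> \<omega>} = {\<omega>\<in>space M. \<Theta> \<omega> = enat s}"
    using Suc by (auto simp: eq_enat_Suc_iff)
  finally show ?thesis .
qed

lemma
  assumes W: "W \<in> borel_measurable (history M X Y t)"
  shows nn_integral_change:
      "(\<integral>\<^sup>+\<omega>. W \<omega> * indicator {\<omega>\<in>space M. \<Theta> \<omega> = enat (Suc t)} \<omega> \<partial>M) =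
       (\<integral>\<^sup>+\<omega>. W \<omega> * ennreal (trans_prob \<pi>\<^sub>0 \<pi> X (Suc t) \<omega>) *
          indicator {\<omega>\<in>space M. enat t < \<Theta> \<omega>} \<omega> \<partial>M)"
    and nn_integral_no_change:
      "(\<integral>\<^sup>+\<omega>. W \<omega> * indicator {\<omega>\<in>space M. enat (Suc t) < \<Theta> \<omega>} \<omega> \<partial>M) =
       (\<integral>\<^sup>+\<omega>. W \<omega> * ennreal (1 - trans_prob \<pi>\<^sub>0 \<pi> X (Suc t) \<omega>) *
          indicator {\<omega>\<in>space M. enat t < \<Theta> \<omega>} \<omega> \<partial>M)"
proof -
  let ?H = "history_latent M X Y \<Theta> (Suc t) {t}"
  let ?A = "{\<omega>\<in>space M. latent \<Theta> (Suc t) \<omega> = 1}"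
  let ?L = "{\<omega>\<in>space M. enat t < \<Theta> \<omega>}"
  let ?p = "trans_prob \<pi>\<^sub>0 \<pi> X (Suc t)"
  have sub: "subalgebra M ?H"
    by (rule subalgebra_M_history_latent)
  interpret H: finite_measure_subalgebra M ?H
    by unfold_locales (rule sub)
  have A [measurable]: "?A \<in> sets M"
    using measurable_sets[OF measurable_latent, of "{1}" "Suc t"]
    by (simp add: vimage_def Int_def conj_commute)
  \<comment> \<open>\<open>transition\<close> speaks of paths in state 0 at time \<open>t\<close>.
    The factor \<open>indicator ?L\<close> confines the integral to them and is measurable for
    \<open>?H\<close>, which contains that state.\<close>
  have W': "(\<lambda>\<omega>. W \<omega> * indicator ?L \<omega>) \<in> borel_measurable ?H"
    by (intro borel_measurable_times_ennreal measurable_from_subalg[OF subalgebra_history_latent W]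
        borel_measurable_indicator sets_history_latent_less) simp
  have tr: "AE \<omega> in M. \<omega> \<in> ?L \<longrightarrow> real_cond_exp M ?H (indicator ?A) \<omega> = ?p \<omega>"
    using transition[of "Suc t"] by (simp add: latent_eq_0_iff)
  have "(\<integral>\<^sup>+\<omega>. W \<omega> * indicator {\<omega>\<in>space M. \<Theta> \<omega> = enat (Suc t)} \<omega> \<partial>M) =
      (\<integral>\<^sup>+\<omega>. W \<omega> * indicator ?L \<omega> * indicator ?A \<omega> \<partial>M)"
    by (intro nn_integral_cong) (auto simp: indicator_def eq_enat_Suc_iff latent_def)
  also have "\<dots> = (\<integral>\<^sup>+\<omega>. W \<omega> * indicator ?L \<omega> * ennreal (real_cond_exp M ?H (indicator ?A) \<omega>) \<partial>M)"
    by (rule nn_integral_indicator_real_cond_exp[OF sub A W'])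
  also have "\<dots> = (\<integral>\<^sup>+\<omega>. W \<omega> * ennreal (?p \<omega>) * indicator ?L \<omega> \<partial>M)"
    by (rule nn_integral_cong_AE) (use tr in eventually_elim, auto simp: indicator_def)
  finally show "(\<integral>\<^sup>+\<omega>. W \<omega> * indicator {\<omega>\<in>space M. \<Theta> \<omega> = enat (Suc t)} \<omega> \<partial>M) =
      (\<integral>\<^sup>+\<omega>. W \<omega> * ennreal (?p \<omega>) * indicator ?L \<omega> \<partial>M)" .
  \<comment> \<open>By linearity of the conditional expectation, the complement of \<open>?A\<close>
    has conditional probability \<open>1 - ?p\<close> on \<open>?L\<close>.\<close>
  have "AE \<omega> in M. real_cond_exp M ?H (indicator (space M - ?A)) \<omega> =
      real_cond_exp M ?H (\<lambda>\<omega>. 1 - indicator ?A \<omega>) \<omega>"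
  proof (rule H.real_cond_exp_cong)
    show "AE \<omega> in M. indicator (space M - ?A) \<omega> = (1 - indicator ?A \<omega> :: real)"
      by (auto simp: indicator_def)
  qed measurable
  moreover have "AE \<omega> in M. real_cond_exp M ?H (\<lambda>\<omega>. 1 - indicator ?A \<omega>) \<omega> =
      real_cond_exp M ?H (\<lambda>\<omega>. 1) \<omega> - real_cond_exp M ?H (indicator ?A) \<omega>"
    by (rule H.real_cond_exp_diff[OF _ integrable_real_indicator[OF A]])
      (simp_all add: less_top[symmetric])
  moreover have "AE \<omega> in M. real_cond_exp M ?H (\<lambda>\<omega>. 1) \<omega> = 1"
    by (rule H.real_cond_exp_F_meas) auto
  ultimately have tr': "AE \<omega> in M. \<omega> \<in> ?L \<longrightarrow>
      real_cond_exp M ?H (indicator (space M - ?A)) \<omega> = 1 - ?p \<omega>"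
    using tr by eventually_elim auto
  have "(\<integral>\<^sup>+\<omega>. W \<omega> * indicator {\<omega>\<in>space M. enat (Suc t) < \<Theta> \<omega>} \<omega> \<partial>M) =
      (\<integral>\<^sup>+\<omega>. W \<omega> * indicator ?L \<omega> * indicator (space M - ?A) \<omega> \<partial>M)"
  proof (intro nn_integral_cong)
    fix \<omega> assume "\<omega> \<in> space M"
    moreover have "enat t < \<Theta> \<omega>" if "enat (Suc t) < \<Theta> \<omega>"
      using that by (cases "\<Theta> \<omega>") auto
    ultimately show "W \<omega> * indicator {\<omega>\<in>space M. enat (Suc t) < \<Theta> \<omega>} \<omega> =
        W \<omega> * indicator ?L \<omega> * indicator (space M - ?A) \<omega>"
      by (auto simp: indicator_def latent_def)
  qed
  also have "\<dots> = (\<integral>\<^sup>+\<omega>. W \<omega> * indicator ?L \<omega> *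
      ennreal (real_cond_exp M ?H (indicator (space M - ?A)) \<omega>) \<partial>M)"
    by (rule nn_integral_indicator_real_cond_exp[OF sub sets.compl_sets[OF A] W'])
  also have "\<dots> = (\<integral>\<^sup>+\<omega>. W \<omega> * ennreal (1 - ?p \<omega>) * indicator ?L \<omega> \<partial>M)"
    by (rule nn_integral_cong_AE) (use tr' in eventually_elim, auto simp: indicator_def)
  finally show "(\<integral>\<^sup>+\<omega>. W \<omega> * indicator {\<omega>\<in>space M. enat (Suc t) < \<Theta> \<omega>} \<omega> \<partial>M) =
      (\<integral>\<^sup>+\<omega>. W \<omega> * ennreal (1 - ?p \<omega>) * indicator ?L \<omega> \<partial>M)" .
qed

section \<open>The response law before and after the change\<close>

text \<open>The weight may involve the latent states up to and including the current one, since
  \<open>response\<close> conditions on all of them.\<close>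

lemma nn_integral_response:
  assumes W: "W \<in> borel_measurable (history_latent M X Y \<Theta> (Suc t) {0..Suc t})"
    and C: "C \<in> sets borel"
  shows "(\<integral>\<^sup>+\<omega>. W \<omega> * indicator C (Y (Suc t) \<omega>) \<partial>M) =
    (\<integral>\<^sup>+\<omega>. W \<omega> * (\<integral>\<^sup>+y. ennreal (if enat (Suc t) < \<Theta> \<omega> then f (X (Suc t) \<omega>) y else g (X (Suc t) \<omega>) y)
       * indicator C y \<partial>\<mu>) \<partial>M)"
proof -
  let ?H = "history_latent M X Y \<Theta> (Suc t) {0..Suc t}"
  let ?A = "{\<omega>\<in>space M. Y (Suc t) \<omega> \<in> C}"
  let ?p = "\<lambda>\<omega> y. if enat (Suc t) < \<Theta> \<omega> then f (X (Suc t) \<omega>) y else g (X (Suc t) \<omega>) y"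
  have A: "?A \<in> sets M"
    using measurable_sets[OF Y_measurable C, of "Suc t"] by (simp add: vimage_def Int_def conj_commute)
  \<comment> \<open>\<open>measure\<close> would send an infinite value to 0; total mass 1 of the
    densities excludes this.\<close>
  have meas: "ennreal (measure (density \<mu> (\<lambda>y. ennreal (?p \<omega> y))) C) =
      (\<integral>\<^sup>+y. ennreal (?p \<omega> y) * indicator C y \<partial>\<mu>)" if "\<omega> \<in> space M" for \<omega>
  proof -
    let ?q = "\<lambda>y. ennreal (?p \<omega> y)"
    have x: "X (Suc t) \<omega> \<in> {1..K}"
      using that by (intro X_range) auto
    have [measurable]: "?q \<in> borel_measurable \<mu>"
      using x f_measurable g_measurable by simp
    have C\<mu> [measurable]: "C \<in> sets \<mu>"
      using C sets_\<mu> by simp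
    have "integral\<^sup>N \<mu> ?q = 1"
      using f_integral[OF x] g_integral[OF x] by (cases "enat (Suc t) < \<Theta> \<omega>") auto
    moreover have "(\<integral>\<^sup>+y. ?q y * indicator C y \<partial>\<mu>) \<le> integral\<^sup>N \<mu> ?q"
      by (intro nn_integral_mono) (auto simp: indicator_def)
    moreover have "emeasure (density \<mu> ?q) C = (\<integral>\<^sup>+y. ?q y * indicator C y \<partial>\<mu>)"
      by (rule emeasure_density) auto
    ultimately show ?thesis
      by (metis emeasure_eq_ennreal_measure ennreal_one_neq_top top_unique)
  qed
  have "(\<integral>\<^sup>+\<omega>. W \<omega> * indicator C (Y (Suc t) \<omega>) \<partial>M) = (\<integral>\<^sup>+\<omega>. W \<omega> * indicator ?A \<omega> \<partial>M)"
    by (intro nn_integral_cong) (auto simp: indicator_def)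
  also have "\<dots> = (\<integral>\<^sup>+\<omega>. W \<omega> * ennreal (real_cond_exp M ?H (indicator ?A) \<omega>) \<partial>M)"
    by (rule nn_integral_indicator_real_cond_exp[OF subalgebra_M_history_latent A W])
  also have "\<dots> = (\<integral>\<^sup>+\<omega>. W \<omega> * (\<integral>\<^sup>+y. ennreal (?p \<omega> y) * indicator C y \<partial>\<mu>) \<partial>M)"
  proof (rule nn_integral_cong_AE)
    have "AE \<omega> in M. real_cond_exp M ?H (indicator ?A) \<omega> = measure (density \<mu> (\<lambda>y. ennreal (?p \<omega> y))) C"
      using response[of "Suc t", OF _ C] by (simp add: latent_eq_0_iff)
    with AE_space show "AE \<omega> in M. W \<omega> * ennreal (real_cond_exp M ?H (indicator ?A) \<omega>) =
        W \<omega> * (\<integral>\<^sup>+y. ennreal (?p \<omega> y) * indicator C y \<partial>\<mu>)"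
      by eventually_elim (simp only: meas)
  qed
  finally show ?thesis .
qed

text \<open>The vanishing of \<open>W\<close> before the change leaves only the branch
  \<open>g\<close>. Sets \<open>C\<close> suffice here; before the change a likelihood ratio has to
  be integrated, which calls for functions \<open>\<phi>\<close> of the response.\<close>

lemma nn_integral_response_after:
  assumes W: "W \<in> borel_measurable (history_latent M X Y \<Theta> (Suc t) {0..Suc t})"
    and zero: "\<And>\<omega>. \<omega> \<in> space M \<Longrightarrow> enat (Suc t) < \<Theta> \<omega> \<Longrightarrow> W \<omega> = 0"
    and C: "C \<in> sets borel"
  shows "(\<integral>\<^sup>+\<omega>. W \<omega> * indicator C (Y (Suc t) \<omega>) \<partial>M) =
    (\<integral>\<^sup>+\<omega>. W \<omega> * (\<integral>\<^sup>+y. ennreal (g (X (Suc t) \<omega>) y) * indicator C y \<partial>\<mu>) \<partial>M)"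
  unfolding nn_integral_response[OF W C]
proof (rule nn_integral_cong)
  fix \<omega> assume "\<omega> \<in> space M"
  then show "W \<omega> * (\<integral>\<^sup>+y. ennreal (if enat (Suc t) < \<Theta> \<omega> then f (X (Suc t) \<omega>) y else g (X (Suc t) \<omega>) y)
       * indicator C y \<partial>\<mu>) = W \<omega> * (\<integral>\<^sup>+y. ennreal (g (X (Suc t) \<omega>) y) * indicator C y \<partial>\<mu>)"
    using zero by (cases "enat (Suc t) < \<Theta> \<omega>") auto
qed

text \<open>With the treatment fixed to \<open>x\<close>, the conditional law no longer varies with
  \<open>\<omega>\<close>. The law of the response weighted by \<open>W\<close> is therefore the
  density \<open>f x\<close> scaled by the total mass of \<open>W\<close>, and integrating
  \<open>\<phi>\<close> against both sides gives the claim.\<close>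

lemma nn_integral_response_before_arm:
  assumes W: "W \<in> borel_measurable (history_latent M X Y \<Theta> (Suc t) {0..Suc t})"
    and zero: "\<And>\<omega>. \<omega> \<in> space M \<Longrightarrow> W \<omega> \<noteq> 0 \<Longrightarrow> enat (Suc t) < \<Theta> \<omega> \<and> X (Suc t) \<omega> = x"
    and x: "x \<in> {1..K}" and \<phi>: "\<phi> \<in> borel_measurable borel"
  shows "(\<integral>\<^sup>+\<omega>. W \<omega> * \<phi> (Y (Suc t) \<omega>) \<partial>M) =
    (\<integral>\<^sup>+\<omega>. W \<omega> * (\<integral>\<^sup>+y. ennreal (f x y) * \<phi> y \<partial>\<mu>) \<partial>M)"
proof -
  let ?D = "distr (density M W) borel (Y (Suc t))"
  let ?S = "scale_measure (integral\<^sup>N M W) (density \<mu> (\<lambda>y. ennreal (f x y)))"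
  have WM [measurable]: "W \<in> borel_measurable M"
    by (rule measurable_from_subalg[OF subalgebra_M_history_latent W])
  have Y: "Y (Suc t) \<in> M \<rightarrow>\<^sub>M borel"
    by (rule Y_measurable) simp
  have YW: "Y (Suc t) \<in> density M W \<rightarrow>\<^sub>M borel"
    using Y by simp
  have f\<mu> [measurable]: "f x \<in> borel_measurable \<mu>"
    by (rule f_measurable[OF x])
  have \<phi>\<mu> [measurable]: "\<phi> \<in> borel_measurable \<mu>"
    using \<phi> measurable_cong_sets[OF sets_\<mu> refl] by blast
  have int: "integral\<^sup>N ?D h = (\<integral>\<^sup>+\<omega>. W \<omega> * h (Y (Suc t) \<omega>) \<partial>M)"
    if h: "h \<in> borel_measurable borel" for h
    using measurable_compose[OF Y h] h
    by (subst nn_integral_distr[OF YW]) (auto simp: nn_integral_density)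
  \<comment> \<open>The two measures are compared on every Borel set, so the mass of
    \<open>W\<close> may be infinite.\<close>
  have eq: "?D = ?S"
  proof (rule measure_eqI)
    fix C assume "C \<in> sets ?D"
    then have C: "C \<in> sets borel" by simp
    have "emeasure ?D C = integral\<^sup>N ?D (indicator C)"
      using C by simp
    also have "\<dots> = (\<integral>\<^sup>+\<omega>. W \<omega> * indicator C (Y (Suc t) \<omega>) \<partial>M)"
      using C by (intro int) auto
    also have "\<dots> = (\<integral>\<^sup>+\<omega>. W \<omega> * (\<integral>\<^sup>+y. ennreal (f x y) * indicator C y \<partial>\<mu>) \<partial>M)"
      unfolding nn_integral_response[OF W C]
    proof (rule nn_integral_cong)
      fix \<omega> assume "\<omega> \<in> space M"
      then show "W \<omega> * (\<integral>\<^sup>+y. ennreal (if enat (Suc t) < \<Theta> \<omega> then f (X (Suc t) \<omega>) y else g (X (Suc t) \<omega>) y)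
           * indicator C y \<partial>\<mu>) = W \<omega> * (\<integral>\<^sup>+y. ennreal (f x y) * indicator C y \<partial>\<mu>)"
        using zero[of \<omega>] by (cases "W \<omega> = 0") auto
    qed
    also have "\<dots> = emeasure ?S C"
      using C by (simp add: nn_integral_multc emeasure_density sets_\<mu>)
    finally show "emeasure ?D C = emeasure ?S C" .
  qed (simp add: sets_\<mu>)
  have "(\<integral>\<^sup>+\<omega>. W \<omega> * \<phi> (Y (Suc t) \<omega>) \<partial>M) = integral\<^sup>N ?S \<phi>"
    using int[OF \<phi>] unfolding eq by simp
  also have "\<dots> = (\<integral>\<^sup>+\<omega>. W \<omega> * (\<integral>\<^sup>+y. ennreal (f x y) * \<phi> y \<partial>\<mu>) \<partial>M)"
    by (simp add: nn_integral_scale_measure nn_integral_density nn_integral_multc)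
  finally show ?thesis .
qed

text \<open>Partition by the value of \<open>X (Suc t)\<close>: each of the finitely many pieces has
  a constant treatment and falls under the single-treatment case.\<close>

lemma nn_integral_response_before:
  assumes W: "W \<in> borel_measurable (history_latent M X Y \<Theta> (Suc t) {0..Suc t})"
    and zero: "\<And>\<omega>. \<omega> \<in> space M \<Longrightarrow> W \<omega> \<noteq> 0 \<Longrightarrow> enat (Suc t) < \<Theta> \<omega>"
    and \<phi>: "\<And>x. x \<in> {1..K} \<Longrightarrow> \<phi> x \<in> borel_measurable borel"
  shows "(\<integral>\<^sup>+\<omega>. W \<omega> * \<phi> (X (Suc t) \<omega>) (Y (Suc t) \<omega>) \<partial>M) =
    (\<integral>\<^sup>+\<omega>. W \<omega> * (\<integral>\<^sup>+y. ennreal (f (X (Suc t) \<omega>) y) * \<phi> (X (Suc t) \<omega>) y \<partial>\<mu>) \<partial>M)"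
proof -
  let ?I = "\<lambda>x. indicator {\<omega>\<in>space M. X (Suc t) \<omega> = x} :: 'w \<Rightarrow> ennreal"
  let ?c = "\<lambda>x. \<integral>\<^sup>+y. ennreal (f x y) * \<phi> x y \<partial>\<mu>"
  have WM [measurable]: "W \<in> borel_measurable M"
    by (rule measurable_from_subalg[OF subalgebra_M_history_latent W])
  have I: "?I x \<in> borel_measurable (history_latent M X Y \<Theta> (Suc t) {0..Suc t})" for x
  proof (rule measurable_from_subalg[OF subalgebra_history_latent borel_measurable_indicator])
    show "{\<omega>\<in>space M. X (Suc t) \<omega> = x} \<in> sets (history M X Y t)"
      using measurable_sets[OF measurable_into_UNIV[OF measurable_history_X], of "Suc t" t "{x}"]
      by (simp add: vimage_def Int_def conj_commute)
  qed
  have IM [measurable]: "?I x \<in> borel_measurable M" for x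
    by (rule measurable_from_subalg[OF subalgebra_M_history_latent I])
  have WI: "(\<lambda>\<omega>. W \<omega> * ?I x \<omega>) \<in> borel_measurable (history_latent M X Y \<Theta> (Suc t) {0..Suc t})" for x
    by (intro borel_measurable_times_ennreal W I)
  have split: "h (X (Suc t) \<omega>) = (\<Sum>x\<in>{1..K}. ?I x \<omega> * h x)"
    if "\<omega> \<in> space M" for \<omega> and h :: "nat \<Rightarrow> ennreal"
  proof -
    have "(\<Sum>x\<in>{1..K}. ?I x \<omega> * h x) = (\<Sum>x\<in>{1..K}. if x = X (Suc t) \<omega> then h x else 0)"
      using that by (intro sum.cong) (auto simp: indicator_def)
    also have "\<dots> = h (X (Suc t) \<omega>)"
      using X_range[of "Suc t" \<omega>] that by (subst sum.delta) auto
    finally show ?thesis by simp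
  qed
  have \<phi>Y: "(\<lambda>\<omega>. \<phi> x (Y (Suc t) \<omega>)) \<in> borel_measurable M" if "x \<in> {1..K}" for x
    by (rule measurable_compose[OF Y_measurable \<phi>]) (use that in auto)
  have "(\<integral>\<^sup>+\<omega>. W \<omega> * \<phi> (X (Suc t) \<omega>) (Y (Suc t) \<omega>) \<partial>M) =
      (\<integral>\<^sup>+\<omega>. (\<Sum>x\<in>{1..K}. W \<omega> * ?I x \<omega> * \<phi> x (Y (Suc t) \<omega>)) \<partial>M)"
  proof (rule nn_integral_cong)
    fix \<omega> assume "\<omega> \<in> space M"
    from split[OF this, of "\<lambda>x. \<phi> x (Y (Suc t) \<omega>)"]
    show "W \<omega> * \<phi> (X (Suc t) \<omega>) (Y (Suc t) \<omega>) = (\<Sum>x\<in>{1..K}. W \<omega> * ?I x \<omega> * \<phi> x (Y (Suc t) \<omega>))"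
      by (simp only: sum_distrib_left mult.assoc)
  qed
  also have "\<dots> = (\<Sum>x\<in>{1..K}. \<integral>\<^sup>+\<omega>. W \<omega> * ?I x \<omega> * \<phi> x (Y (Suc t) \<omega>) \<partial>M)"
    by (rule nn_integral_sum) (intro borel_measurable_times_ennreal WM IM \<phi>Y)
  also have "\<dots> = (\<Sum>x\<in>{1..K}. \<integral>\<^sup>+\<omega>. W \<omega> * ?I x \<omega> * ?c x \<partial>M)"
    by (intro sum.cong refl nn_integral_response_before_arm[OF WI] \<phi>)
      (use zero in \<open>auto simp: indicator_def split: if_splits\<close>)
  also have "\<dots> = (\<integral>\<^sup>+\<omega>. (\<Sum>x\<in>{1..K}. W \<omega> * ?I x \<omega> * ?c x) \<partial>M)"
    by (rule nn_integral_sum[symmetric]) measurable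
  also have "\<dots> = (\<integral>\<^sup>+\<omega>. W \<omega> * ?c (X (Suc t) \<omega>) \<partial>M)"
  proof (rule nn_integral_cong)
    fix \<omega> assume "\<omega> \<in> space M"
    from split[OF this, of ?c]
    show "(\<Sum>x\<in>{1..K}. W \<omega> * ?I x \<omega> * ?c x) = W \<omega> * ?c (X (Suc t) \<omega>)"
      by (simp only: sum_distrib_left mult.assoc)
  qed
  finally show ?thesis .
qed

section \<open>One time step of the change of measure\<close>

text \<open>Where \<open>f x\<close> is nonzero it cancels. Where it is zero the left side is 0, and
  by \<open>same_zeros\<close> so is \<open>g x\<close> almost everywhere; the value of division by
  zero is thus harmless.\<close>

lemma nn_integral_lik_ratio:
  assumes x: "x \<in> {1..K}"
  shows "(\<integral>\<^sup>+y. ennreal (f x y) * (indicator C y * ennreal (g x y / f x y)) \<partial>\<mu>) =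
    (\<integral>\<^sup>+y. ennreal (g x y) * indicator C y \<partial>\<mu>)"
proof (rule nn_integral_cong_AE)
  show "AE y in \<mu>. ennreal (f x y) * (indicator C y * ennreal (g x y / f x y)) =
      ennreal (g x y) * indicator C y"
    using same_zeros[OF x]
  proof eventually_elim
    case (elim y)
    then show ?case
      using f_nonneg[OF x, of y] g_nonneg[OF x, of y]
      by (cases "f x y = 0") (auto simp: indicator_def ennreal_mult[symmetric])
  qed
qed

text \<open>Rectangles with only two factors suffice, since the new treatment is already measurable
  with respect to the history up to \<open>t\<close>; the response is the only new
  information.\<close>

lemma history_Suc_generator:
  fixes t :: nat
  defines "E \<equiv> {B \<inter> (Y (Suc t) -` C \<inter> space M) | B C. B \<in> sets (history M X Y t) \<and> C \<in> sets borel}"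
  shows "sets (history M X Y (Suc t)) = sigma_sets (space M) E" "Int_stable E"
    "E \<subseteq> Pow (space M)" "space M \<in> E"
proof -
  have E_I: "B \<inter> (Y (Suc t) -` C \<inter> space M) \<in> E"
    if "B \<in> sets (history M X Y t)" "C \<in> sets borel" for B C
    unfolding E_def using that by blast
  have hist: "sets (history M X Y t) \<subseteq> E"
  proof
    fix B assume B: "B \<in> sets (history M X Y t)"
    have "B \<inter> (Y (Suc t) -` UNIV \<inter> space M) = B"
      using sets.sets_into_space[OF B] by auto
    with E_I[OF B, of UNIV] show "B \<in> E"
      by simp
  qed
  show top: "space M \<in> E"
    using hist sets.top[of "history M X Y t"] by auto
  show pow: "E \<subseteq> Pow (space M)"
    unfolding E_def by auto
  show "Int_stable E"
  proof (rule Int_stableI)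
    fix a b assume "a \<in> E" "b \<in> E"
    then obtain B C B' C' where *: "B \<in> sets (history M X Y t)" "C \<in> sets borel"
        "B' \<in> sets (history M X Y t)" "C' \<in> sets borel"
        "a = B \<inter> (Y (Suc t) -` C \<inter> space M)" "b = B' \<inter> (Y (Suc t) -` C' \<inter> space M)"
      unfolding E_def by blast
    have "a \<inter> b = (B \<inter> B') \<inter> (Y (Suc t) -` (C \<inter> C') \<inter> space M)"
      unfolding *(5,6) by blast
    also have "\<dots> \<in> E"
      by (intro E_I sets.Int *)
    finally show "a \<inter> b \<in> E" .
  qed
  \<comment> \<open>For the inclusion of the history in the generated sigma-algebra, all treatments
    and responses up to \<open>Suc t\<close> are shown to be measurable for
    \<open>?S\<close>.\<close>
  let ?S = "sigma (space M) E"
  have S: "sets ?S = sigma_sets (space M) E" "space ?S = space M"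
    using pow by (auto simp: sets_measure_of space_measure_of_conv)
  have sub: "subalgebra ?S (history M X Y t)"
    using hist S by (auto simp: subalgebra_def)
  have X: "sets (vimage_algebra (space M) (X i) (count_space UNIV)) \<subseteq> sets ?S" if "i \<in> {1..Suc t}" for i
    using that S(2) by (intro sets_image_in_sets measurable_into_UNIV[OF
        measurable_from_subalg[OF sub measurable_history_X]]) auto
  have "Y i \<in> ?S \<rightarrow>\<^sub>M borel" if "i \<in> {1..Suc t}" for i
  proof (cases "i = Suc t")
    case True
    show ?thesis
    proof (rule measurableI)
      fix C :: "'y set" assume C: "C \<in> sets borel"
      have "Y i -` C \<inter> space ?S = space M \<inter> (Y (Suc t) -` C \<inter> space M)"
        unfolding S(2) True by blast
      also have "\<dots> \<in> E"
        using E_I[OF sets.top C] by simp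
      also have "E \<subseteq> sets ?S"
        unfolding S(1) by auto
      finally show "Y i -` C \<inter> space ?S \<in> sets ?S" .
    qed simp
  next
    case False
    with that show ?thesis
      by (intro measurable_from_subalg[OF sub measurable_history_Y]) auto
  qed
  then have Y: "sets (vimage_algebra (space M) (Y i) borel) \<subseteq> sets ?S" if "i \<in> {1..Suc t}" for i
    using that S(2) by (intro sets_image_in_sets) auto
  have "sets (history M X Y (Suc t)) \<subseteq> sets ?S"
    unfolding sets_history
    by (rule sets.sigma_sets_subset[of _ ?S, unfolded S(2)]) (intro Un_least UN_least X Y)
  moreover have "E \<subseteq> sets (history M X Y (Suc t))"
  proof
    fix a assume "a \<in> E"
    then obtain B C where *: "B \<in> sets (history M X Y t)" "C \<in> sets borel"
        "a = B \<inter> (Y (Suc t) -` C \<inter> space M)"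
      unfolding E_def by blast
    moreover have "B \<in> sets (history M X Y (Suc t))"
      using *(1) subalgebra_history_mono[of t "Suc t" M X Y] unfolding subalgebra_def by auto
    moreover have "Y (Suc t) -` C \<inter> space M \<in> sets (history M X Y (Suc t))"
      using measurable_sets[OF measurable_history_Y *(2), of "Suc t" "Suc t" Y M X] by simp
    ultimately show "a \<in> sets (history M X Y (Suc t))"
      by simp
  qed
  then have "sigma_sets (space M) E \<subseteq> sets (history M X Y (Suc t))"
    using sets.sigma_sets_subset[of E "history M X Y (Suc t)"] by simp
  ultimately show "sets (history M X Y (Suc t)) = sigma_sets (space M) E"
    unfolding S(1) by blast
qed

text \<open>\<open>prev\<close> says that, on the history up to \<open>t\<close>, restricting to
  \<open>E\<close> amounts to restricting to survival past \<open>t\<close> with density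
  \<open>Q\<close>. The step multiplies this density by one factor. \<open>E\<close> and
  \<open>Q\<close> stay abstract so that \<open>prev\<close> can come either from the induction
  hypothesis or directly from the transition law.\<close>

lemma change_of_measure_Suc:
  assumes E: "E \<in> sets (history_latent M X Y \<Theta> (Suc t) {0..Suc t})"
    and after: "\<And>\<omega>. \<omega> \<in> E \<Longrightarrow> \<not> enat (Suc t) < \<Theta> \<omega>"
    and Q: "Q \<in> borel_measurable (history M X Y t)"
    and prev: "\<And>V. V \<in> borel_measurable (history M X Y t) \<Longrightarrow>
      (\<integral>\<^sup>+\<omega>. V \<omega> * indicator E \<omega> \<partial>M) =
      (\<integral>\<^sup>+\<omega>. V \<omega> * Q \<omega> * indicator {\<omega>\<in>space M. enat t < \<Theta> \<omega>} \<omega> \<partial>M)"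
    and W: "W \<in> borel_measurable (history M X Y (Suc t))"
  shows "(\<integral>\<^sup>+\<omega>. W \<omega> * indicator E \<omega> \<partial>M) =
    (\<integral>\<^sup>+\<omega>. W \<omega> * (Q \<omega> * ennreal (lik_ratio f g X Y (Suc t) \<omega> / (1 - trans_prob \<pi>\<^sub>0 \<pi> X (Suc t) \<omega>)) *
       indicator {\<omega>\<in>space M. enat (Suc t) < \<Theta> \<omega>} \<omega>) \<partial>M)"
proof -
  let ?H = "history_latent M X Y \<Theta> (Suc t) {0..Suc t}"
  let ?p = "trans_prob \<pi>\<^sub>0 \<pi> X (Suc t)"
  \<comment> \<open>Split off from the likelihood ratio because it is known at time
    \<open>t\<close>, whereas the ratio involves the new response.\<close>
  let ?r = "\<lambda>\<omega>. ennreal (1 / (1 - ?p \<omega>))"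
  let ?\<Lambda> = "lik_ratio f g X Y (Suc t)"
  let ?L = "\<lambda>t. {\<omega>\<in>space M. enat t < \<Theta> \<omega>}"
  let ?G = "\<lambda>C x. \<integral>\<^sup>+y. ennreal (g x y) * indicator C y \<partial>\<mu>"
  note toH = measurable_from_subalg[OF subalgebra_history_latent]
  note toM = measurable_from_subalg[OF subalgebra_M_history]
  have EM: "E \<in> sets M"
    using E subalgebra_M_history_latent by (auto simp: subalgebra_def)
  have r: "?r \<in> borel_measurable (history M X Y t)"
    using measurable_trans_prob[of t] by simp
  have LH: "?L (Suc t) \<in> sets ?H"
    by (rule sets_history_latent_less) simp
  have LM: "?L (Suc t) \<in> sets M"
    using LH subalgebra_M_history_latent by (auto simp: subalgebra_def)
  show ?thesis
  proof (rule nn_integral_eq_of_generator[OF subalgebra_M_history history_Suc_generator _ _ _ _ W])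
    show "indicator E \<in> borel_measurable M"
      using EM by simp
    show "(\<lambda>\<omega>. Q \<omega> * ennreal (?\<Lambda> \<omega> / (1 - ?p \<omega>)) * indicator (?L (Suc t)) \<omega>) \<in> borel_measurable M"
      using toM[OF Q] toM[OF measurable_lik_ratio] toM[OF measurable_trans_prob] LM by measurable
    show "integral\<^sup>N M (indicator E) \<noteq> \<infinity>"
      using EM by (simp add: emeasure_eq_measure)
    fix a assume "a \<in> {B \<inter> (Y (Suc t) -` C \<inter> space M) | B C. B \<in> sets (history M X Y t) \<and> C \<in> sets borel}"
    then obtain B C where B: "B \<in> sets (history M X Y t)" and C: "C \<in> sets borel"
      and a: "a = B \<inter> (Y (Suc t) -` C \<inter> space M)"
      by blast
    have iB: "indicator B \<in> borel_measurable (history M X Y t)"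
      using B by simp
    \<comment> \<open>The integrated response depends on \<open>X (Suc t)\<close> alone, which is
      known at time \<open>t\<close>; this makes the weight admissible for
      \<open>prev\<close>.\<close>
    have V: "(\<lambda>\<omega>. indicator B \<omega> * ?G C (X (Suc t) \<omega>)) \<in> borel_measurable (history M X Y t)"
      by (intro borel_measurable_times_ennreal iB measurable_compose[OF measurable_history_X]) auto
    \<comment> \<open>Survival past \<open>Suc t\<close> involves the latent state, so this weight
      is placed in \<open>?H\<close> instead of the history.\<close>
    have U: "(\<lambda>\<omega>. indicator B \<omega> * Q \<omega> * ?r \<omega> * indicator (?L (Suc t)) \<omega>) \<in> borel_measurable ?H"
      by (intro borel_measurable_times_ennreal toH iB Q r borel_measurable_indicator LH)
    have "(\<integral>\<^sup>+\<omega>. indicator E \<omega> * indicator a \<omega> \<partial>M) =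
        (\<integral>\<^sup>+\<omega>. (indicator B \<omega> * indicator E \<omega>) * indicator C (Y (Suc t) \<omega>) \<partial>M)"
      by (intro nn_integral_cong) (auto simp: a indicator_def)
    also have "\<dots> = (\<integral>\<^sup>+\<omega>. (indicator B \<omega> * indicator E \<omega>) * ?G C (X (Suc t) \<omega>) \<partial>M)"
    proof (rule nn_integral_response_after[OF _ _ C])
      show "(\<lambda>\<omega>. indicator B \<omega> * indicator E \<omega> :: ennreal) \<in> borel_measurable ?H"
        by (intro borel_measurable_times_ennreal toH[OF iB] borel_measurable_indicator E)
    qed (use after in \<open>auto simp: indicator_def\<close>)
    also have "\<dots> = (\<integral>\<^sup>+\<omega>. (indicator B \<omega> * ?G C (X (Suc t) \<omega>)) * indicator E \<omega> \<partial>M)"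
      by (simp only: mult_ac)
    also have "\<dots> = (\<integral>\<^sup>+\<omega>. (indicator B \<omega> * ?G C (X (Suc t) \<omega>)) * Q \<omega> * indicator (?L t) \<omega> \<partial>M)"
      by (rule prev[OF V])
    \<comment> \<open>A factor 1 is inserted as
      \<open>?r \<omega> * ennreal (1 - ?p \<omega>)\<close>, possible since
      \<open>?p \<omega> < 1\<close>. The second factor is then absorbed by the passage from
      survival past \<open>t\<close> to survival past \<open>Suc t\<close>.\<close>
    also have "\<dots> = (\<integral>\<^sup>+\<omega>. ((indicator B \<omega> * ?G C (X (Suc t) \<omega>)) * Q \<omega> * ?r \<omega>) *
        ennreal (1 - ?p \<omega>) * indicator (?L t) \<omega> \<partial>M)"
    proof (rule nn_integral_cong)
      fix \<omega> assume "\<omega> \<in> space M"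
      then have "?r \<omega> * ennreal (1 - ?p \<omega>) = 1"
        using trans_prob_range[of \<omega> "Suc t"] by (subst ennreal_mult[symmetric]) auto
      then show "(indicator B \<omega> * ?G C (X (Suc t) \<omega>)) * Q \<omega> * indicator (?L t) \<omega> =
          ((indicator B \<omega> * ?G C (X (Suc t) \<omega>)) * Q \<omega> * ?r \<omega>) *
          ennreal (1 - ?p \<omega>) * indicator (?L t) \<omega>"
        by (simp only: mult.assoc[of _ "?r \<omega>"] mult_1_right)
    qed
    also have "\<dots> = (\<integral>\<^sup>+\<omega>. ((indicator B \<omega> * ?G C (X (Suc t) \<omega>)) * Q \<omega> * ?r \<omega>) *
        indicator (?L (Suc t)) \<omega> \<partial>M)"
      by (rule nn_integral_no_change[symmetric]) (intro borel_measurable_times_ennreal V Q r)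
    also have "\<dots> = (\<integral>\<^sup>+\<omega>. (indicator B \<omega> * Q \<omega> * ?r \<omega> * indicator (?L (Suc t)) \<omega>) *
        ?G C (X (Suc t) \<omega>) \<partial>M)"
      by (simp only: mult_ac)
    also have "\<dots> = (\<integral>\<^sup>+\<omega>. (indicator B \<omega> * Q \<omega> * ?r \<omega> * indicator (?L (Suc t)) \<omega>) *
        (\<integral>\<^sup>+y. ennreal (f (X (Suc t) \<omega>) y) *
          (indicator C y * ennreal (g (X (Suc t) \<omega>) y / f (X (Suc t) \<omega>) y)) \<partial>\<mu>) \<partial>M)"
      using nn_integral_lik_ratio[OF X_range[of "Suc t"]] by (intro nn_integral_cong) simp
    also have "\<dots> = (\<integral>\<^sup>+\<omega>. (indicator B \<omega> * Q \<omega> * ?r \<omega> * indicator (?L (Suc t)) \<omega>) *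
        (\<lambda>x y. indicator C y * ennreal (g x y / f x y)) (X (Suc t) \<omega>) (Y (Suc t) \<omega>) \<partial>M)"
    proof (rule nn_integral_response_before[OF U, symmetric])
      fix x assume x: "x \<in> {1..K}"
      show "(\<lambda>y. indicator C y * ennreal (g x y / f x y)) \<in> borel_measurable borel"
        using C borel_measurable_f[OF x] borel_measurable_g[OF x] by measurable
    qed (auto simp: indicator_def split: if_splits)
    also have "\<dots> = (\<integral>\<^sup>+\<omega>. Q \<omega> * ennreal (?\<Lambda> \<omega> / (1 - ?p \<omega>)) * indicator (?L (Suc t)) \<omega> *
        indicator a \<omega> \<partial>M)"
    proof (rule nn_integral_cong)
      fix \<omega> assume \<omega>: "\<omega> \<in> space M"
      have "ennreal (?\<Lambda> \<omega> / (1 - ?p \<omega>)) = ?r \<omega> * ennreal (?\<Lambda> \<omega>)"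
        using trans_prob_range[OF \<omega>, of "Suc t"] lik_ratio_nonneg[OF \<omega>, of "Suc t"]
        by (subst ennreal_mult[symmetric]) auto
      moreover have "?\<Lambda> \<omega> = g (X (Suc t) \<omega>) (Y (Suc t) \<omega>) / f (X (Suc t) \<omega>) (Y (Suc t) \<omega>)"
        by (simp add: lik_ratio_def)
      moreover have "indicator a \<omega> = (indicator B \<omega> * indicator C (Y (Suc t) \<omega>) :: ennreal)"
        using \<omega> by (auto simp: a indicator_def)
      ultimately show "(indicator B \<omega> * Q \<omega> * ?r \<omega> * indicator (?L (Suc t)) \<omega>) *
          (\<lambda>x y. indicator C y * ennreal (g x y / f x y)) (X (Suc t) \<omega>) (Y (Suc t) \<omega>) =
          Q \<omega> * ennreal (?\<Lambda> \<omega> / (1 - ?p \<omega>)) * indicator (?L (Suc t)) \<omega> * indicator a \<omega>"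
        by (simp only: mult_ac)
    qed
    finally show "(\<integral>\<^sup>+\<omega>. indicator E \<omega> * indicator a \<omega> \<partial>M) =
        (\<integral>\<^sup>+\<omega>. Q \<omega> * ennreal (?\<Lambda> \<omega> / (1 - ?p \<omega>)) * indicator (?L (Suc t)) \<omega> *
        indicator a \<omega> \<partial>M)" .
  qed
qed

section \<open>Induction over time\<close>

lemma R_stat_nonneg: "\<omega> \<in> space M \<Longrightarrow> 0 \<le> R_stat f g \<pi>\<^sub>0 \<pi> X Y s t \<omega>"
  unfolding R_stat_def using trans_prob_range lik_ratio_nonneg
  by (intro mult_nonneg_nonneg prod_nonneg divide_nonneg_nonneg ballI) (auto simp: less_imp_le)

lemma measurable_trans_prob_current: "trans_prob \<pi>\<^sub>0 \<pi> X t \<in> borel_measurable (history M X Y t)"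
proof (cases t)
  case (Suc r)
  then show ?thesis
    using measurable_from_subalg[OF subalgebra_history_mono measurable_trans_prob[of r], of t] by simp
qed (simp add: trans_prob_def[abs_def])

lemma measurable_R_stat: "R_stat f g \<pi>\<^sub>0 \<pi> X Y s t \<in> borel_measurable (history M X Y t)"
  if "s \<le> t"
proof -
  note mono = measurable_from_subalg[OF subalgebra_history_mono]
  show ?thesis
    unfolding R_stat_def[abs_def]
    by (intro borel_measurable_times borel_measurable_prod borel_measurable_divide borel_measurable_diff
        borel_measurable_const mono[OF _ measurable_trans_prob_current] mono[OF _ measurable_lik_ratio])
      (use that in auto)
qed

text \<open>\<open>W\<close> is arbitrary in the induction, because the step calls the hypothesis
  with weights built from the integrated response at the next treatment.\<close>

theorem nn_integral_change_point:
  assumes "s \<le> t" "W \<in> borel_measurable (history M X Y t)"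
  shows "(\<integral>\<^sup>+\<omega>. W \<omega> * indicator {\<omega>\<in>space M. \<Theta> \<omega> = enat s} \<omega> \<partial>M) =
    (\<integral>\<^sup>+\<omega>. W \<omega> * ennreal (R_stat f g \<pi>\<^sub>0 \<pi> X Y s t \<omega>)
       * indicator {\<omega>\<in>space M. enat t < \<Theta> \<omega>} \<omega> \<partial>M)"
  using assms
proof (induction t arbitrary: W)
  case 0
  let ?L = "{\<omega>\<in>space M. enat 0 < \<Theta> \<omega>}" and ?E = "{\<omega>\<in>space M. \<Theta> \<omega> = enat 0}"
  have s: "s = 0" using 0 by simp
  \<comment> \<open>The history at time 0 has no generators, so its sigma-algebra is trivial and the
    weight is constant.\<close>
  obtain c where c: "\<And>\<omega>. \<omega> \<in> space M \<Longrightarrow> W \<omega> = c"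
  proof -
    obtain \<omega>\<^sub>0 where \<omega>\<^sub>0: "\<omega>\<^sub>0 \<in> space M"
      using not_empty by blast
    have "W -` {W \<omega>\<^sub>0} \<inter> space M \<in> sets (history M X Y 0)"
      using measurable_sets[OF 0(2), of "{W \<omega>\<^sub>0}"] by simp
    then have "W -` {W \<omega>\<^sub>0} \<inter> space M \<in> {{}, space M}"
      by (simp add: sets_history sigma_sets_empty_eq)
    then have "W \<omega> = W \<omega>\<^sub>0" if "\<omega> \<in> space M" for \<omega>
      using that \<omega>\<^sub>0 by blast
    then show thesis by (rule that)
  qed
  have E: "?E \<in> sets M"
    using sets_history_latent_eq[of 0 "{0}" "Suc 0"] subalgebra_M_history_latent[of 0 "{0}"]
    by (auto simp: subalgebra_def)
  have L: "?L = space M - ?E"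
    by (auto simp: zero_enat_def[symmetric])
  have "?E = {\<omega>\<in>space M. latent \<Theta> 0 \<omega> = 1}"
    by (auto simp: latent_def zero_enat_def[symmetric])
  then have pE: "emeasure M ?E = ennreal \<pi>\<^sub>0"
    using initial by (simp add: emeasure_eq_measure)
  then have pL: "emeasure M ?L = ennreal (1 - \<pi>\<^sub>0)"
    unfolding L using E \<pi>\<^sub>0_range prob_compl[OF E] by (simp add: emeasure_eq_measure)
  have "(\<integral>\<^sup>+\<omega>. W \<omega> * indicator ?E \<omega> \<partial>M) = (\<integral>\<^sup>+\<omega>. c * indicator ?E \<omega> \<partial>M)"
    by (intro nn_integral_cong) (simp add: c)
  also have "\<dots> = c * ennreal \<pi>\<^sub>0"
    unfolding nn_integral_cmult_indicator[OF E] pE ..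
  \<comment> \<open>The first factor is \<open>R_stat\<close> for \<open>s = t = 0\<close>, as the
    likelihood ratio at time 0 is 1; the second is the probability of no change at time 0.\<close>
  also have "\<dots> = c * (ennreal (\<pi>\<^sub>0 / (1 - \<pi>\<^sub>0)) * ennreal (1 - \<pi>\<^sub>0))"
    using \<pi>\<^sub>0_range by (subst ennreal_mult[symmetric]) auto
  also have "\<dots> = (\<integral>\<^sup>+\<omega>. c * ennreal (\<pi>\<^sub>0 / (1 - \<pi>\<^sub>0)) * indicator ?L \<omega> \<partial>M)"
    using E pL by (subst nn_integral_cmult_indicator) (auto simp: L mult.assoc)
  also have "\<dots> = (\<integral>\<^sup>+\<omega>. W \<omega> * ennreal (R_stat f g \<pi>\<^sub>0 \<pi> X Y 0 0 \<omega>) * indicator ?L \<omega> \<partial>M)"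
    by (intro nn_integral_cong) (simp add: c R_stat_def trans_prob_def lik_ratio_def)
  finally show ?case
    unfolding s .
next
  case (Suc t)
  let ?E = "{\<omega>\<in>space M. \<Theta> \<omega> = enat s}"
  let ?F = "\<lambda>\<omega>. lik_ratio f g X Y (Suc t) \<omega> / (1 - trans_prob \<pi>\<^sub>0 \<pi> X (Suc t) \<omega>)"
  have E: "?E \<in> sets (history_latent M X Y \<Theta> (Suc t) {0..Suc t})"
    using Suc.prems(1) by (intro sets_history_latent_eq) auto
  have after: "\<not> enat (Suc t) < \<Theta> \<omega>" if "\<omega> \<in> ?E" for \<omega>
    using that Suc.prems(1) by auto
  \<comment> \<open>\<open>q\<close> is \<open>R_stat\<close> at \<open>Suc t\<close> without its
    last factor \<open>?F\<close>. For \<open>s = Suc t\<close> the product has only that factor,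
    which leaves the transition probability; otherwise \<open>R_stat\<close> at time
    \<open>t\<close> remains.\<close>
  obtain q where q: "q \<in> borel_measurable (history M X Y t)"
    and q0: "\<And>\<omega>. \<omega> \<in> space M \<Longrightarrow> 0 \<le> q \<omega>"
    and qR: "\<And>\<omega>. R_stat f g \<pi>\<^sub>0 \<pi> X Y s (Suc t) \<omega> = q \<omega> * ?F \<omega>"
    and prev: "\<And>V. V \<in> borel_measurable (history M X Y t) \<Longrightarrow>
      (\<integral>\<^sup>+\<omega>. V \<omega> * indicator ?E \<omega> \<partial>M) =
      (\<integral>\<^sup>+\<omega>. V \<omega> * ennreal (q \<omega>) * indicator {\<omega>\<in>space M. enat t < \<Theta> \<omega>} \<omega> \<partial>M)"
  proof (cases "s = Suc t")
    case True
    show thesis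
    proof (rule that[of "trans_prob \<pi>\<^sub>0 \<pi> X (Suc t)"])
      show "0 \<le> trans_prob \<pi>\<^sub>0 \<pi> X (Suc t) \<omega>" if "\<omega> \<in> space M" for \<omega>
        using trans_prob_range[OF that] by auto
    qed (use True in \<open>auto intro: measurable_trans_prob nn_integral_change simp: R_stat_def\<close>)
  next
    case False
    with Suc.prems(1) have s: "s \<le> t" by simp
    show thesis
    proof (rule that[of "R_stat f g \<pi>\<^sub>0 \<pi> X Y s t"])
      show "R_stat f g \<pi>\<^sub>0 \<pi> X Y s (Suc t) \<omega> = R_stat f g \<pi>\<^sub>0 \<pi> X Y s t \<omega> * ?F \<omega>" for \<omega>
        using s by (simp add: R_stat_def)
    qed (use s in \<open>auto intro: measurable_R_stat R_stat_nonneg Suc.IH\<close>)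
  qed
  have "(\<integral>\<^sup>+\<omega>. W \<omega> * indicator ?E \<omega> \<partial>M) =
      (\<integral>\<^sup>+\<omega>. W \<omega> * (ennreal (q \<omega>) * ennreal (?F \<omega>) *
         indicator {\<omega>\<in>space M. enat (Suc t) < \<Theta> \<omega>} \<omega>) \<partial>M)"
    by (rule change_of_measure_Suc[OF E after _ prev Suc.prems(2)]) (use q in auto)
  also have "\<dots> = (\<integral>\<^sup>+\<omega>. W \<omega> * ennreal (R_stat f g \<pi>\<^sub>0 \<pi> X Y s (Suc t) \<omega>) *
         indicator {\<omega>\<in>space M. enat (Suc t) < \<Theta> \<omega>} \<omega> \<partial>M)"
  proof (rule nn_integral_cong)
    fix \<omega> assume \<omega>: "\<omega> \<in> space M"
    have "0 \<le> ?F \<omega>"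
      using lik_ratio_nonneg[OF \<omega>, of "Suc t"] trans_prob_range[OF \<omega>, of "Suc t"] by auto
    then show "W \<omega> * (ennreal (q \<omega>) * ennreal (?F \<omega>) * indicator {\<omega>\<in>space M. enat (Suc t) < \<Theta> \<omega>} \<omega>) =
        W \<omega> * ennreal (R_stat f g \<pi>\<^sub>0 \<pi> X Y s (Suc t) \<omega>) *
         indicator {\<omega>\<in>space M. enat (Suc t) < \<Theta> \<omega>} \<omega>"
      unfolding qR by (simp only: ennreal_mult[OF q0[OF \<omega>]] mult.assoc)
  qed
  finally show ?case .
qed

end

theorem lemmaA1:
  fixes M :: "'w measure"
    and K :: nat
    and \<mu> :: "'y::polish_space measure"
    and f g :: "nat \<Rightarrow> 'y \<Rightarrow> real"
    and \<pi>\<^sub>0 :: real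
    and \<pi> :: "nat \<Rightarrow> (nat \<Rightarrow> nat) \<Rightarrow> real"
    and X :: "nat \<Rightarrow> 'w \<Rightarrow> nat"
    and Y :: "nat \<Rightarrow> 'w \<Rightarrow> 'y"
    and \<Theta> :: "'w \<Rightarrow> enat"
    and s t :: nat
    and u :: "(nat \<Rightarrow> 'y) \<Rightarrow> ennreal"
  assumes "change_point_model M K \<mu> f g \<pi>\<^sub>0 \<pi> X Y \<Theta>"
    and "s \<le> t"
    and "u \<in> borel_measurable (\<Pi>\<^sub>M i\<in>{1..t}. borel)"
  shows "(\<integral>\<^sup>+\<omega>. u (\<lambda>i\<in>{1..t}. Y i \<omega>) * indicator {\<omega>\<in>space M. \<Theta> \<omega> = enat s} \<omega> \<partial>M) =
    (\<integral>\<^sup>+\<omega>. u (\<lambda>i\<in>{1..t}. Y i \<omega>) * ennreal (R_stat f g \<pi>\<^sub>0 \<pi> X Y s t \<omega>)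
       * indicator {\<omega>\<in>space M. enat t < \<Theta> \<omega>} \<omega> \<partial>M)"
proof -
  interpret change_point_model M K \<mu> f g \<pi>\<^sub>0 \<pi> X Y \<Theta>
    by fact
  \<comment> \<open>A measurable function of the responses is an admissible weight; for
    \<open>t = 0\<close> the index set is empty and the weight is a constant.\<close>
  have "(\<lambda>\<omega>. \<lambda>i\<in>{1..t}. Y i \<omega>) \<in> history M X Y t \<rightarrow>\<^sub>M (\<Pi>\<^sub>M i\<in>{1..t}. borel)"
    by (intro measurable_restrict measurable_history_Y)
  then have "(\<lambda>\<omega>. u (\<lambda>i\<in>{1..t}. Y i \<omega>)) \<in> borel_measurable (history M X Y t)"
    by (rule measurable_compose) fact
  with \<open>s \<le> t\<close> show ?thesis
    by (rule nn_integral_change_point)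
qed

end
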